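(* Let $G$ be a simple undirected graph without loops on the vertex set $\{1,\dots,n\}$, with positive edge weights, let $L=L(G)$ be its (weighted) Laplacian matrix and let $\vec{d}=(d_1,\dots,d_n)^\top$ be its vertex degree sequence. Suppose that for some real $n\times n$ matrix $D$ the identity $$LD+2I=(2\cdot\vec{1}-\vec{d})\vec{1}^\top$$ holds. Then $G$ is a tree. Moreover, if $D$ has zero diagonal, then $D$ is the distance matrix $D(G^{-1})$ of the tree $G^{-1}$.
   Context: $I$ is the identity matrix and $\vec{1}$ the all-ones column vector of dimension $n$. For a graph $G$ with positive edge weights $w_{ij}>0$ ($ij\in E(G)$), the weight matrix $W(G)=(w_{ij}(G))$ is the symmetric matrix with $w_{ij}(G)=w_{ij}$ if $ij\in E(G)$ and $0$ otherwise; the adjacency matrix $X(G)$ is the symmetric 0/1 matrix with $x_{ij}(G)=1$ iff $ij\in E(G)$. The degree sequence is $\vec{d}(G)=X(G)\vec{1}$ (i.e. $d_i$ is the number of edges at vertex $i$, not weighted). The Laplacian is $L(G)=\operatorname{diag}(W(G)\vec{1})-W(G)$. $G^{-1}$ denotes the graph $G$ with every edge weight replaced by its reciprocal: $w_{ij}(G^{-1})=1/w_{ij}(G)$. The distance $d_{ij}(G)$ between vertices $i,j$ is the minimum total weight of a path joining them; the distance matrix $D(G)$ has zero diagonal and $(i,j)$-entry $d_{ij}(G)$. A tree is a connected graph with $n$ vertices and $n-1$ edges. *)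

theory Defs
  imports "HOL-Analysis.Analysis"
begin

text \<open>
  A weighted graph on the finite vertex type \<open>'n\<close> (all elements of the type are vertices, so
  the number of vertices is \<open>CARD('n)\<close>). Edges are unordered pairs; the value of \<open>weight\<close>
  outside \<open>edges\<close> is irrelevant.
\<close>

record 'n wgraph =
  edges :: "'n set set"
  weight :: "'n set \<Rightarrow> real"

definition simple_wgraph :: "'n::finite wgraph \<Rightarrow> bool" where
  "simple_wgraph G \<longleftrightarrow>
     (\<forall>e\<in>edges G. card e = 2) \<and> (\<forall>e\<in>edges G. weight G e > 0)"

definition inverse_wgraph :: "'n::finite wgraph \<Rightarrow> 'n wgraph" where
  "inverse_wgraph G = \<lparr>edges = edges G, weight = (\<lambda>e. 1 / weight G e)\<rparr>"

definition weight_matrix :: "'n::finite wgraph \<Rightarrow> real^'n^'n" where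
  "weight_matrix G = (\<chi> i j. if {i, j} \<in> edges G then weight G {i, j} else 0)"

definition adjacency_matrix :: "'n::finite wgraph \<Rightarrow> real^'n^'n" where
  "adjacency_matrix G = (\<chi> i j. if {i, j} \<in> edges G then 1 else 0)"

definition degree_vec :: "'n::finite wgraph \<Rightarrow> real^'n" where
  "degree_vec G = adjacency_matrix G *v 1"

definition diag_matrix :: "real^'n \<Rightarrow> real^'n^'n" where
  "diag_matrix v = (\<chi> i j. if i = j then v $ i else 0)"

definition laplacian :: "'n::finite wgraph \<Rightarrow> real^'n^'n" where
  "laplacian G = diag_matrix (weight_matrix G *v 1) - weight_matrix G"

definition graph_path :: "'n::finite wgraph \<Rightarrow> 'n \<Rightarrow> 'n list \<Rightarrow> 'n \<Rightarrow> bool" where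
  "graph_path G u p v \<longleftrightarrow>
     p \<noteq> [] \<and> hd p = u \<and> last p = v \<and> distinct p \<and>
     (\<forall>k. Suc k < length p \<longrightarrow> {p ! k, p ! Suc k} \<in> edges G)"

definition path_weight :: "'n::finite wgraph \<Rightarrow> 'n list \<Rightarrow> real" where
  "path_weight G p = (\<Sum>k<length p - 1. weight G {p ! k, p ! Suc k})"

definition connected_graph :: "'n::finite wgraph \<Rightarrow> bool" where
  "connected_graph G \<longleftrightarrow> (\<forall>u v. \<exists>p. graph_path G u p v)"

definition tree_graph :: "'n::finite wgraph \<Rightarrow> bool" where
  "tree_graph G \<longleftrightarrow> connected_graph G \<and> card (edges G) = CARD('n) - 1"

text \<open>
  There are only finitely many paths, as their vertices are distinct, so the minimum exists
  as soon as \<open>u\<close> and \<open>v\<close> are joined by a path. Otherwise the value of \<open>Min {}\<close> is unspecified.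
\<close>

definition graph_dist :: "'n::finite wgraph \<Rightarrow> 'n \<Rightarrow> 'n \<Rightarrow> real" where
  "graph_dist G u v = Min {path_weight G p |p. graph_path G u p v}"

definition distance_matrix :: "'n::finite wgraph \<Rightarrow> real^'n^'n" where
  "distance_matrix G = (\<chi> i j. if i = j then 0 else graph_dist G i j)"

definition outer_product :: "real^'n \<Rightarrow> real^'n \<Rightarrow> real^'n^'n" where
  "outer_product u v = (columnvector u :: real^1^'n) ** (rowvector v :: real^'n^1)"

end

theory Submission
  imports Defs
begin

text \<open>
  The columns of \<open>D\<close> solve the Laplace equations \<open>L x = 2\<cdot>1 - d - 2 e\<^sub>j\<close>. The sum of
  \<open>L x\<close> over a union of components vanishes. If some \<open>j\<close> is inside such a union and another outside,
  the two columns contradict each other, so \<open>G\<close> is connected; summing over all vertices then gives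
  \<open>n - 1\<close> edges.

  For the distances, fix a root \<open>r\<close> and let every other vertex \<open>v\<close> choose a parent \<open>p v\<close> that
  is one step closer to \<open>r\<close>. The edges \<open>{v, p v}\<close> are distinct, and there are \<open>n - 1\<close> of them, so they
  are all the edges. Hence the potential \<open>y\<close> that grows by \<open>1 / w\<close> from \<open>p v\<close> to \<open>v\<close>
  changes by exactly \<open>1 / w\<close> along every edge. It follows both that \<open>y\<close> is the distance
  to \<open>r\<close> in the inverse graph and that it solves the same Laplace equation as column \<open>r\<close> of \<open>D\<close>.
  By the maximum principle the two solutions differ by a constant, which the zero diagonal makes zero.
\<close>

section \<open>Weighted Laplacian and degree sum\<close>

lemma weight_matrix_commute: "weight_matrix G $ i $ k = weight_matrix G $ k $ i"
  by (simp add: weight_matrix_def insert_commute)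

lemma weight_matrix_nonneg: "simple_wgraph G \<Longrightarrow> 0 \<le> weight_matrix G $ i $ k"
  by (auto simp: weight_matrix_def simple_wgraph_def less_imp_le)

lemma weight_matrix_eq_0: "{i, k} \<notin> edges G \<Longrightarrow> weight_matrix G $ i $ k = 0"
  by (simp add: weight_matrix_def)

lemma weight_matrix_pos:
  "\<lbrakk>simple_wgraph G; {i, k} \<in> edges G\<rbrakk> \<Longrightarrow> 0 < weight_matrix G $ i $ k"
  by (simp add: weight_matrix_def simple_wgraph_def)

lemma degree_vec_nth: "degree_vec G $ i = (\<Sum>k\<in>UNIV. if {i, k} \<in> edges G then 1 else 0)"
  by (simp add: degree_vec_def adjacency_matrix_def matrix_vector_mult_def)

lemma laplacian_mult_nth:
  "(laplacian G *v x) $ i = (\<Sum>k\<in>UNIV. weight_matrix G $ i $ k * (x $ i - x $ k))"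
proof -
  have "(diag_matrix v *v x) $ i = v $ i * x $ i" for v
    by (simp add: diag_matrix_def matrix_vector_mult_def if_distrib[of "\<lambda>a. a * _"] cong: if_cong)
  then show ?thesis
    by (simp add: laplacian_def matrix_vector_mult_diff_rdistrib)
      (simp add: matrix_vector_mult_def sum_distrib_right right_diff_distrib sum_subtractf)
qed

text \<open>No edge leaves \<open>S\<close>, so only pairs inside \<open>S\<close> contribute. The
  weights are symmetric, so the terms for (i, k) and (k, i) cancel.\<close>

lemma sum_laplacian_closed_set:
  assumes "\<And>i k. \<lbrakk>i \<in> S; {i, k} \<in> edges G\<rbrakk> \<Longrightarrow> k \<in> S"
  shows "(\<Sum>i\<in>S. (laplacian G *v x) $ i) = 0"
proof -
  let ?w = "\<lambda>i k. weight_matrix G $ i $ k"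
  have "(\<Sum>i\<in>S. (laplacian G *v x) $ i) = (\<Sum>i\<in>S. \<Sum>k\<in>S. ?w i k * (x $ i - x $ k))"
    unfolding laplacian_mult_nth
    using assms by (intro sum.cong sum.mono_neutral_right) (auto intro: weight_matrix_eq_0)
  also have "\<dots> = (\<Sum>i\<in>S. \<Sum>k\<in>S. ?w i k * x $ i) - (\<Sum>i\<in>S. \<Sum>k\<in>S. ?w i k * x $ k)"
    by (simp add: right_diff_distrib sum_subtractf)
  also have "(\<Sum>i\<in>S. \<Sum>k\<in>S. ?w i k * x $ k) = (\<Sum>i\<in>S. \<Sum>k\<in>S. ?w i k * x $ i)"
    by (subst sum.swap) (simp add: weight_matrix_commute[of G])
  finally show ?thesis by simp
qed

text \<open>At a maximum of \<open>x\<close> all summands of the Laplacian are nonnegative and add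
  up to 0, so every neighbour attains the maximum too. Connectedness is phrased through sets closed
  under adjacency because it is applied to the set of maximizers.\<close>

lemma laplacian_kernel_const:
  assumes "simple_wgraph G"
    and conn: "\<And>S. \<lbrakk>S \<noteq> {}; \<And>i k. \<lbrakk>i \<in> S; {i, k} \<in> edges G\<rbrakk> \<Longrightarrow> k \<in> S\<rbrakk> \<Longrightarrow> S = UNIV"
    and ker: "laplacian G *v x = 0"
  shows "x $ i = x $ j"
proof -
  define M where "M = Max (range (($) x))"
  have le: "x $ k \<le> M" for k
    unfolding M_def by simp
  have "M \<in> range (($) x)"
    unfolding M_def by (rule Max_in) auto
  then have ne: "{i. x $ i = M} \<noteq> {}"
    by auto
  have "x $ k = M" if "x $ i = M" "{i, k} \<in> edges G" for i k
  proof -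
    have "(\<Sum>k\<in>UNIV. weight_matrix G $ i $ k * (x $ i - x $ k)) = 0"
      using ker by (simp flip: laplacian_mult_nth)
    then have "weight_matrix G $ i $ k * (x $ i - x $ k) = 0"
      by (subst (asm) sum_nonneg_eq_0_iff)
        (auto simp: that(1) le weight_matrix_nonneg[OF assms(1)])
    then show ?thesis
      using weight_matrix_pos[OF assms(1) that(2)] that(1) by simp
  qed
  then have "{i. x $ i = M} = UNIV"
    using conn[OF ne] by blast
  then show ?thesis by (metis UNIV_I mem_Collect_eq)
qed

text \<open>Double counting of incidences: every edge has exactly two ends.\<close>

lemma sum_degree_vec:
  assumes "simple_wgraph G"
  shows "(\<Sum>i\<in>UNIV. degree_vec G $ i) = 2 * real (card (edges G))"
proof -
  have deg: "degree_vec G $ i = (\<Sum>e\<in>edges G. if i \<in> e then 1 else 0)" for i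
  proof -
    have "bij_betw (\<lambda>k. {i, k}) {k. {i, k} \<in> edges G} {e \<in> edges G. i \<in> e}"
    proof (rule bij_betwI')
      fix e assume e: "e \<in> {e \<in> edges G. i \<in> e}"
      then have "card e = 2" using assms by (auto simp: simple_wgraph_def)
      then obtain a b where "e = {a, b}" by (auto simp: card_2_iff)
      then show "\<exists>k\<in>{k. {i, k} \<in> edges G}. e = {i, k}"
        using e by (auto simp: insert_commute)
    qed (auto simp: doubleton_eq_iff)
    then show ?thesis
      by (simp add: degree_vec_nth sum.If_cases bij_betw_same_card Collect_conj_eq)
  qed
  have "(\<Sum>i\<in>UNIV. degree_vec G $ i) = (\<Sum>e\<in>edges G. \<Sum>i\<in>UNIV. if i \<in> e then 1 else 0)"
    unfolding deg by (rule sum.swap)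
  also have "\<dots> = (\<Sum>e\<in>edges G. real (card e))"
    by (simp add: sum.If_cases)
  also have "\<dots> = (\<Sum>e\<in>edges G. 2)"
    using assms by (intro sum.cong) (auto simp: simple_wgraph_def)
  finally show ?thesis by simp
qed

section \<open>Parent functions, paths and distances\<close>

text \<open>Take for \<open>h v\<close> the length of a shortest walk from \<open>v\<close> to
  \<open>r\<close>, and for \<open>p v\<close> the next vertex on such a walk.\<close>

lemma parent_function_exists:
  fixes G :: "'n::finite wgraph"
  assumes conn: "\<And>S. \<lbrakk>S \<noteq> {}; \<And>i k. \<lbrakk>i \<in> S; {i, k} \<in> edges G\<rbrakk> \<Longrightarrow> k \<in> S\<rbrakk> \<Longrightarrow> S = UNIV"
  shows "\<exists>h p. h r = (0::nat) \<and> (\<forall>v. v \<noteq> r \<longrightarrow> {v, p v} \<in> edges G \<and> h v = Suc (h (p v)))"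
proof -
  define R where "R = {(a, b). {a, b} \<in> edges G}"
  define h where "h v = (LEAST n. (v, r) \<in> R ^^ n)" for v
  have "{v. (v, r) \<in> R\<^sup>*} = UNIV"
  proof (rule conn)
    fix i k assume "i \<in> {v. (v, r) \<in> R\<^sup>*}" "{i, k} \<in> edges G"
    then have "(k, i) \<in> R" "(i, r) \<in> R\<^sup>*" by (simp_all add: R_def insert_commute)
    then show "k \<in> {v. (v, r) \<in> R\<^sup>*}" by (simp add: converse_rtrancl_into_rtrancl)
  qed auto
  then have "\<exists>n. (v, r) \<in> R ^^ n" for v
    by (auto simp: rtrancl_power)
  then have h: "(v, r) \<in> R ^^ h v" for v
    unfolding h_def by (rule LeastI_ex)
  have h_le: "h v \<le> n" if "(v, r) \<in> R ^^ n" for v n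
    unfolding h_def using that by (rule Least_le)
  have "\<exists>u. {v, u} \<in> edges G \<and> h v = Suc (h u)" if "v \<noteq> r" for v
  proof (cases "h v")
    case 0
    with h[of v] that show ?thesis by simp
  next
    case (Suc n)
    with h[of v] obtain u where u: "(v, u) \<in> R" "(u, r) \<in> R ^^ n"
      by (metis relpow_Suc_D2)
    \<comment> \<open>Prepending the edge to a shortest walk from \<open>u\<close> gives this bound;
      minimality of \<open>h u\<close> gives the reverse one.\<close>
    have "h v \<le> Suc (h u)"
      using u(1) h[of u] by (intro h_le relpow_Suc_I2)
    with h_le[OF u(2)] Suc u(1) show ?thesis
      by (auto simp: R_def)
  qed
  then obtain p where "\<And>v. v \<noteq> r \<Longrightarrow> {v, p v} \<in> edges G \<and> h v = Suc (h (p v))"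
    by metis
  moreover have "h r = 0"
    using h_le[of r 0] by simp
  ultimately show ?thesis by blast
qed

lemma graph_dist_eqI:
  assumes "graph_path G u p v" "path_weight G p = c"
    and "\<And>q. graph_path G u q v \<Longrightarrow> c \<le> path_weight G q"
  shows "graph_dist G u v = c"
  unfolding graph_dist_def
proof (rule Min_eqI)
  have "finite {q :: 'a list. set q \<subseteq> UNIV \<and> distinct q}"
    by (rule finite_subset_distinct) simp
  then have "finite {q. graph_path G u q v}"
    by (rule rev_finite_subset) (auto simp: graph_path_def)
  then show "finite {path_weight G q |q. graph_path G u q v}"
    by simp
qed (use assms in auto)

text \<open>The differences of \<open>y\<close> telescope along the path, and each is bounded by the
  weight of its edge.\<close>

lemma potential_le_path_weight:
  assumes "graph_path G u q v"
    and "\<And>a b. {a, b} \<in> edges G \<Longrightarrow> y a - y b \<le> weight G {a, b}"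
  shows "y u - y v \<le> path_weight G q"
proof -
  have q: "q \<noteq> []" "hd q = u" "last q = v"
    "\<And>k. Suc k < length q \<Longrightarrow> {q ! k, q ! Suc k} \<in> edges G"
    using assms(1) by (auto simp: graph_path_def)
  have "y u - y v = (\<Sum>k<length q - 1. y (q ! k) - y (q ! Suc k))"
    using q(1-3) sum_lessThan_telescope'[of "\<lambda>k. y (q ! k)" "length q - 1"]
    by (simp add: hd_conv_nth last_conv_nth)
  also have "\<dots> \<le> path_weight G q"
    unfolding path_weight_def by (intro sum_mono assms(2) q(4)) auto
  finally show ?thesis .
qed

text \<open>Each application of \<open>p\<close> lowers \<open>h\<close> by one until the root is
  reached. Hence the iterates are distinct and arrive at \<open>r\<close>, the only vertex of height
  0, after exactly \<open>h v\<close> steps.\<close>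

lemma parent_path:
  assumes h_root: "h r = (0::nat)"
    and edge: "\<And>v. v \<noteq> r \<Longrightarrow> {v, p v} \<in> edges G"
    and h_parent: "\<And>v. v \<noteq> r \<Longrightarrow> h v = Suc (h (p v))"
  shows "graph_path G v (map (\<lambda>t. (p ^^ t) v) [0..<Suc (h v)]) r"
proof -
  have h_iter: "h ((p ^^ t) v) = h v - t" if "t \<le> h v" for t
    using that
  proof (induction t)
    case (Suc t)
    then have "(p ^^ t) v \<noteq> r" using h_root by auto
    with h_parent Suc show ?case by fastforce
  qed simp
  have "(p ^^ h v) v = r"
    using h_iter[of "h v"] h_parent[of "(p ^^ h v) v"] by auto
  moreover have "inj_on (\<lambda>t. (p ^^ t) v) {0..<Suc (h v)}"
    by (rule inj_on_inverseI[where g = "\<lambda>a. h v - h a"]) (simp add: h_iter)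
  moreover have "{(p ^^ t) v, (p ^^ Suc t) v} \<in> edges G" if "t < h v" for t
  proof -
    have "(p ^^ t) v \<noteq> r" using h_iter[of t] that h_root by auto
    then show ?thesis using edge by auto
  qed
  ultimately show ?thesis
    by (auto simp: graph_path_def distinct_map hd_map last_map nth_append simp del: upt_Suc funpow.simps)
qed

section \<open>The Laplace equation on a rooted tree\<close>

lemma tree_laplace_solution:
  fixes G :: "'n::finite wgraph"
  assumes simple: "simple_wgraph G"
    and conn: "\<And>S. \<lbrakk>S \<noteq> {}; \<And>i k. \<lbrakk>i \<in> S; {i, k} \<in> edges G\<rbrakk> \<Longrightarrow> k \<in> S\<rbrakk> \<Longrightarrow> S = UNIV"
    and card: "card (edges G) = CARD('n) - 1"
    and x: "\<And>i. (laplacian G *v x) $ i = 2 - degree_vec G $ i - (if i = r then 2 else 0)"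
    and "x $ r = 0"
  shows "x $ v = graph_dist (inverse_wgraph G) v r"
proof -
  obtain h p where h_root: "h r = (0::nat)"
    and edge: "\<And>v. v \<noteq> r \<Longrightarrow> {v, p v} \<in> edges G"
    and h_parent: "\<And>v. v \<noteq> r \<Longrightarrow> h v = Suc (h (p v))"
    using parent_function_exists[where G = G and r = r, OF conn] by blast
  \<comment> \<open>Otherwise \<open>h v\<close> would exceed itself by two. Two vertices could
    share a parent edge only by being each other's parent, so this yields injectivity.\<close>
  have pp: "p (p v) \<noteq> v" if "v \<noteq> r" "p v \<noteq> r" for v
    using h_parent that by (metis n_not_Suc_n Suc_n_not_le_n le_SucI le_refl)
  have "inj_on (\<lambda>v. {v, p v}) (UNIV - {r})"
    using pp by (force simp: inj_on_def doubleton_eq_iff)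
  then have "card ((\<lambda>v. {v, p v}) ` (UNIV - {r})) = card (edges G)"
    by (simp add: card_image card card_Diff_singleton)
  then have edges_eq: "(\<lambda>v. {v, p v}) ` (UNIV - {r}) = edges G"
    using edge by (intro card_subset_eq) auto
  define y where "y v = (\<Sum>t<h v. 1 / weight G {(p ^^ t) v, (p ^^ Suc t) v})" for v
  have y_root: "y r = 0"
    by (simp add: y_def h_root)
  \<comment> \<open>Splitting off the summand at \<open>t = 0\<close> and shifting the index leaves
    the sum that defines \<open>y (p v)\<close>.\<close>
  have y_parent: "y v = y (p v) + 1 / weight G {v, p v}" if "v \<noteq> r" for v
    unfolding y_def h_parent[OF that] sum.lessThan_Suc_shift
    by (simp add: funpow_swap1 del: funpow.simps(2)) (simp add: funpow_swap1)
  have w_pos: "weight G e > 0" if "e \<in> edges G" for e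
    using simple that by (simp add: simple_wgraph_def)

  have lap_y: "(laplacian G *v (\<chi> i. y i)) $ i = 2 - degree_vec G $ i - (if i = r then 2 else 0)" for i
  proof -
    \<comment> \<open>Weight times potential difference is 1 on the edge to the parent and -1 on an
      edge to a child. Written as twice the parent indicator minus the edge indicator, it sums to 2
      minus the degree, and to minus the degree at the root, which has no parent edge.\<close>
    have summand: "weight_matrix G $ i $ k * (y i - y k) =
        2 * (if k = p i then if i \<noteq> r then 1 else 0 else 0) - (if {i, k} \<in> edges G then 1 else 0)" for k
    proof (cases "{i, k} \<in> edges G")
      case True
      then obtain v where v: "v \<noteq> r" "{i, k} = {v, p v}"
        unfolding edges_eq[symmetric] by auto
      have w: "weight G {i, k} > 0" using w_pos True .
      from v(2) consider "i = v" "k = p v" | "i = p v" "k = v"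
        by (auto simp: doubleton_eq_iff)
      then show ?thesis
      proof cases
        case 1
        then show ?thesis
          using y_parent[OF v(1)] v(1) True w by (simp add: weight_matrix_def)
      next
        case 2
        then have "y i - y k = - (1 / weight G {i, k})"
          using y_parent[OF v(1)] by (simp add: insert_commute)
        \<comment> \<open>Here \<open>i = p v\<close> and \<open>k = v\<close>, so the excluded case
          would give \<open>p (p v) = v\<close>.\<close>
        moreover have "\<not> (k = p i \<and> i \<noteq> r)"
          using 2 pp v(1) by metis
        ultimately show ?thesis
          using True w by (auto simp: weight_matrix_def)
      qed
    next
      case False
      then show ?thesis using edge[of i] by (auto simp: weight_matrix_eq_0)
    qed
    show ?thesis
      by (simp add: laplacian_mult_nth summand sum_subtractf degree_vec_nth flip: sum_distrib_left)
  qed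
  have "laplacian G *v (x - (\<chi> i. y i)) = 0"
    by (simp add: vec_eq_iff matrix_vector_mult_diff_distrib x lap_y)
  from laplacian_kernel_const[OF simple conn this, of v r]
  have "x $ v = y v"
    using \<open>x $ r = 0\<close> y_root by simp
  also have "\<dots> = graph_dist (inverse_wgraph G) v r"
  proof (rule graph_dist_eqI[symmetric])
    show "graph_path (inverse_wgraph G) v (map (\<lambda>t. (p ^^ t) v) [0..<Suc (h v)]) r"
      using h_root edge h_parent by (intro parent_path) (simp_all add: inverse_wgraph_def)
    show "path_weight (inverse_wgraph G) (map (\<lambda>t. (p ^^ t) v) [0..<Suc (h v)]) = y v"
      unfolding path_weight_def y_def
      by (intro sum.cong) (simp_all add: inverse_wgraph_def del: upt_Suc)
    fix q assume q: "graph_path (inverse_wgraph G) v q r"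
    \<comment> \<open>The difference is the inverse weight up to sign, whichever end is the parent.
      So no path to the root weighs less than \<open>y v\<close>, the weight of the parent
      path.\<close>
    have "y a - y b \<le> weight (inverse_wgraph G) {a, b}" if "{a, b} \<in> edges (inverse_wgraph G)" for a b
    proof -
      have ab: "{a, b} \<in> edges G" using that by (simp add: inverse_wgraph_def)
      then obtain u where u: "u \<noteq> r" "{a, b} = {u, p u}"
        unfolding edges_eq[symmetric] by auto
      have "\<bar>y a - y b\<bar> = 1 / weight G {a, b}"
        using u(2) y_parent[OF u(1)] w_pos[OF ab] by (auto simp: doubleton_eq_iff insert_commute)
      then show ?thesis by (simp add: inverse_wgraph_def)
    qed
    from potential_le_path_weight[OF q, of y, OF this] y_root
    show "y v \<le> path_weight (inverse_wgraph G) q" by simp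
  qed
  finally show ?thesis .
qed

theorem theorem1:
  fixes G :: "'n::finite wgraph" and D :: "real^'n^'n"
  assumes "simple_wgraph G"
    and "laplacian G ** D + 2 *\<^sub>R mat 1 = outer_product (2 *\<^sub>R 1 - degree_vec G) 1"
  shows "tree_graph G \<and>
    ((\<forall>i. D $ i $ i = 0) \<longrightarrow> D = distance_matrix (inverse_wgraph G))"
proof -
  \<comment> \<open>The outer product is constant along each row; the multiple of the identity
    becomes the correction at \<open>i = j\<close>.\<close>
  have col: "(laplacian G *v column j D) $ i = 2 - degree_vec G $ i - (if i = j then 2 else 0)" for i j
  proof -
    have "(laplacian G ** D + 2 *\<^sub>R mat 1) $ i $ j = 2 - degree_vec G $ i"
      unfolding assms(2)
      by (simp add: outer_product_def matrix_matrix_mult_def columnvector_def rowvector_def)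
    then show ?thesis
      by (auto simp: matrix_matrix_mult_def matrix_vector_mult_def column_def mat_def split: if_splits)
  qed
  \<comment> \<open>The left-hand side is free of \<open>j\<close>: comparing a \<open>j\<close>
    inside \<open>S\<close> with one outside would yield 2 = 0.\<close>
  have sum_closed: "(\<Sum>i\<in>S. 2 - degree_vec G $ i) = (if j \<in> S then 2 else 0)"
    if "\<And>i k. \<lbrakk>i \<in> S; {i, k} \<in> edges G\<rbrakk> \<Longrightarrow> k \<in> S" for S j
    using sum_laplacian_closed_set[where S = S and G = G and x = "column j D", OF that]
    by (simp add: col sum_subtractf)
  have conn: "S = UNIV"
    if "S \<noteq> {}" "\<And>i k. \<lbrakk>i \<in> S; {i, k} \<in> edges G\<rbrakk> \<Longrightarrow> k \<in> S" for S
  proof (rule ccontr)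
    assume "S \<noteq> UNIV"
    with \<open>S \<noteq> {}\<close> obtain i j where "i \<in> S" "j \<notin> S" by auto
    with sum_closed[of S i] sum_closed[of S j] that(2) show False by auto
  qed
  \<comment> \<open>The set of all vertices is closed and contains every \<open>j\<close>; its
    degree sum is twice the number of edges.\<close>
  have "2 * real CARD('n) - 2 * real (card (edges G)) = 2"
    using sum_closed[of UNIV] by (simp add: sum_subtractf sum_degree_vec[OF assms(1)])
  then have card: "card (edges G) = CARD('n) - 1"
    by linarith
  have "\<exists>q. graph_path G u q v" for u v
  proof -
    obtain h p where "h v = (0::nat)" "\<And>u. u \<noteq> v \<Longrightarrow> {u, p u} \<in> edges G"
      "\<And>u. u \<noteq> v \<Longrightarrow> h u = Suc (h (p u))"
      using parent_function_exists[where G = G and r = v, OF conn] by blast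
    from parent_path[OF this] show ?thesis by blast
  qed
  with card have "tree_graph G"
    by (simp add: tree_graph_def connected_graph_def)
  moreover have "D = distance_matrix (inverse_wgraph G)" if "\<forall>i. D $ i $ i = 0"
  proof -
    \<comment> \<open>Column \<open>j\<close> is treated with \<open>j\<close> as the root, where
      the zero diagonal normalizes the solution.\<close>
    have "column j D $ i = graph_dist (inverse_wgraph G) i j" for i j
      using that by (intro tree_laplace_solution assms(1) conn card col) (auto simp: column_def)
    then show ?thesis
      using that by (auto simp: vec_eq_iff distance_matrix_def column_def)
  qed
  ultimately show ?thesis by blast
qed

end
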